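(* Let $n\ge 2p+1$, let $1\le t\le p$, and let $2\le q\le h_p(t)$, where $n,p,q,t$ are integers. Then $$f_t^\sharp(n,p,q)\ge\max\left\{\left\lceil\frac{h_n(t)}{h_n(t)-\left\lfloor\frac{n}{p+1}\right\rfloor}\right\rceil,\ \left\lceil\frac{h_n(t)\,C_{\min}(p,n,t;\mathcal T_n(t))}{g(p,n)\,h_p(t)}\right\rceil\right\}.$$
   Context: $B_n=2^{[n]}$ denotes the Boolean lattice of all subsets of $[n]$ ordered by inclusion. A $t$-chain in a poset is a set of $t$ distinct pairwise comparable elements. $\mathcal T_n(t)$ is the set of all $t$-chains of $B_n$ and $h_n(t)=|\mathcal T_n(t)|$. An induced copy of a poset $P$ in a poset $R$ is the image $f(P)$ of an injection $f:P\to R$ such that $x\le y$ in $P$ if and only if $f(x)\le f(y)$ in $R$. $g(p,n)$ is the number of induced copies of $B_p$ in $B_n$. For $T\in\mathcal T_n(t)$, $C_T(p,n,t)$ is the number of induced copies of $B_p$ in $B_n$ that contain $T$ (i.e. copies $S\subseteq B_n$ with $T\subseteq S$), and for $\mathcal T\subseteq\mathcal T_n(t)$, $C_{\min}(p,n,t;\mathcal T)=\min_{T\in\mathcal T}C_T(p,n,t)$. A strong $(p,q,t)$-coloring of $B_n$ is a coloring of the $t$-chains of $B_n$ such that, for every induced copy $S\subseteq B_n$ of $B_p$, the $t$-chains contained in $S$ receive at least $q$ distinct colors. $f_t^\sharp(n,p,q)$ is the minimum number of colors in a strong $(p,q,t)$-coloring of $B_n$. *)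

theory Defs
  imports Complex_Main
begin

definition boolean_lattice :: "nat \<Rightarrow> nat set set" where
  "boolean_lattice n = Pow {1..n}"

text \<open>Finite posets are represented by their carrier sets inside a type of class \<open>order\<close>;
  for \<open>nat set\<close> the order \<open>\<le>\<close> is inclusion.\<close>

definition chains_of_size :: "'a::order set \<Rightarrow> nat \<Rightarrow> 'a set set" where
  "chains_of_size P t =
     {T. T \<subseteq> P \<and> finite T \<and> card T = t \<and> Complete_Partial_Order.chain (\<le>) T}"

definition induced_copies :: "'a::order set \<Rightarrow> 'b::order set \<Rightarrow> 'b set set" where
  "induced_copies P R =
     {f ` P | f. inj_on f P \<and> f ` P \<subseteq> R \<and> (\<forall>x\<in>P. \<forall>y\<in>P. x \<le> y \<longleftrightarrow> f x \<le> f y)}"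

definition t_chains :: "nat \<Rightarrow> nat \<Rightarrow> nat set set set" where
  "t_chains n t = chains_of_size (boolean_lattice n) t"

definition num_chains :: "nat \<Rightarrow> nat \<Rightarrow> nat" where
  "num_chains n t = card (t_chains n t)"

definition copies :: "nat \<Rightarrow> nat \<Rightarrow> nat set set set" where
  "copies p n = induced_copies (boolean_lattice p) (boolean_lattice n)"

definition num_copies :: "nat \<Rightarrow> nat \<Rightarrow> nat" where
  "num_copies p n = card (copies p n)"

text \<open>The number of copies containing a chain \<open>T\<close>; the parameter \<open>t\<close> of
  $C_T(p,n,t)$ is the size of \<open>T\<close> and so is not a separate argument.\<close>

definition copies_containing :: "nat \<Rightarrow> nat \<Rightarrow> nat set set \<Rightarrow> nat" where
  "copies_containing p n T = card {S \<in> copies p n. T \<subseteq> S}"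

text \<open>Meaningful for nonempty sets \<open>\<T>\<close> of chains of equal size in
  \<open>boolean_lattice n\<close>.\<close>

definition C_min :: "nat \<Rightarrow> nat \<Rightarrow> nat set set set \<Rightarrow> nat" where
  "C_min p n \<T> = Min (copies_containing p n ` \<T>)"

text \<open>A colouring is a total function of which only the values on \<open>t_chains n t\<close> matter.\<close>

definition strong_coloring ::
    "nat \<Rightarrow> nat \<Rightarrow> nat \<Rightarrow> nat \<Rightarrow> (nat set set \<Rightarrow> 'c) \<Rightarrow> bool" where
  "strong_coloring n p q t c \<longleftrightarrow>
     (\<forall>S \<in> copies p n. q \<le> card (c ` chains_of_size S t))"

text \<open>Since \<open>t_chains n t\<close> is finite, natural numbers suffice as colours. For
  \<open>q \<le> num_chains p t\<close> an injective colouring is strong, so the minimum is attained.\<close>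

definition f_sharp :: "nat \<Rightarrow> nat \<Rightarrow> nat \<Rightarrow> nat \<Rightarrow> nat" where
  "f_sharp t n p q =
     (LEAST k. \<exists>c :: nat set set \<Rightarrow> nat.
        strong_coloring n p q t c \<and> card (c ` t_chains n t) = k)"

end

theory Submission
  imports Defs
begin

text \<open>
  Fix a strong colouring with \<open>k\<close> colours. As \<open>q \<ge> 2\<close>, no copy of \<open>B\<^sub>p\<close> has all its \<open>t\<close>-chains
  in one colour. The two lower bounds on \<open>k\<close> are of quite different strength.

  The first bound comes from disjoint copies. Cutting \<open>[n]\<close> into \<open>m = \<lfloor>n / (p + 1)\<rfloor>\<close> blocks of
  \<open>p + 1\<close> points gives \<open>m\<close> pairwise disjoint copies of \<open>B\<^sub>p\<close>: in each block one point belongs to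
  all the sets of the copy and the other \<open>p\<close> points vary freely (\<open>disjoint_block_copies\<close>). Each of
  these copies contains a chain outside a given colour class, and these chains are distinct since
  the copies are disjoint and chains are nonempty. So every colour class has at most
  \<open>h\<^sub>n(t) - m\<close> chains (\<open>color_class_plus_disjoint_copies_le\<close>), and since the \<open>k\<close> classes cover all
  chains, \<open>h\<^sub>n(t) \<le> k (h\<^sub>n(t) - m)\<close>.

  The second bound never exceeds \<open>1\<close>. Every copy of \<open>B\<^sub>p\<close> contains exactly \<open>h\<^sub>p(t)\<close> chains, so
  counting the pairs of a chain and a copy containing it shows that \<open>C\<^sub>T\<close> sums to
  \<open>g(p,n) h\<^sub>p(t)\<close> over all chains \<open>T\<close>, while each of the \<open>h\<^sub>n(t)\<close> summands is at least the minimum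
  (\<open>num_chains_mult_C_min_le\<close>). Any colouring of a nonempty set of chains uses a colour.

  An injective colouring is strong when \<open>q \<le> h\<^sub>p(t)\<close>, so the minimum defining \<open>f_sharp\<close> is
  attained and the bounds for one colouring apply to it.
\<close>

section \<open>Chains and copies\<close>

lemma finite_boolean_lattice: "finite (boolean_lattice n)"
  by (simp add: boolean_lattice_def)

lemma finite_chains_of_size: "finite P \<Longrightarrow> finite (chains_of_size P t)"
  by (rule finite_subset[of _ "Pow P"]) (auto simp: chains_of_size_def)

lemma finite_t_chains: "finite (t_chains n t)"
  unfolding t_chains_def by (intro finite_chains_of_size finite_boolean_lattice)

lemma copies_subset: "S \<in> copies p n \<Longrightarrow> S \<subseteq> boolean_lattice n"
  by (auto simp: copies_def induced_copies_def)

lemma finite_copies: "finite (copies p n)"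
proof (rule finite_subset)
  show "copies p n \<subseteq> Pow (boolean_lattice n)"
    using copies_subset by blast
qed (simp add: finite_boolean_lattice)

lemma chains_of_size_subset:
  "S \<subseteq> P \<Longrightarrow> chains_of_size S t = {T \<in> chains_of_size P t. T \<subseteq> S}"
  by (auto simp: chains_of_size_def)

text \<open>Taking images under an order embedding is a bijection between the chains of the two posets.\<close>

lemma card_chains_of_size_embedding_image:
  assumes inj: "inj_on f P" and emb: "\<forall>x\<in>P. \<forall>y\<in>P. x \<le> y \<longleftrightarrow> f x \<le> f y"
  shows "card (chains_of_size (f ` P) t) = card (chains_of_size P t)"
proof -
  have chain_iff: "f ` T \<in> chains_of_size (f ` P) t \<longleftrightarrow> T \<in> chains_of_size P t" if "T \<subseteq> P" for T
  proof -
    have injT: "inj_on f T"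
      using inj that by (rule inj_on_subset)
    have "Complete_Partial_Order.chain (\<le>) (f ` T) \<longleftrightarrow> Complete_Partial_Order.chain (\<le>) T"
      using emb that unfolding Complete_Partial_Order.chain_def by (simp add: subset_iff)
    then show ?thesis
      using that injT
      by (auto simp: chains_of_size_def card_image finite_image_iff)
  qed
  have "chains_of_size (f ` P) t = (`) f ` chains_of_size P t"
  proof (intro equalityI subsetI)
    fix U assume U: "U \<in> chains_of_size (f ` P) t"
    then have "U \<subseteq> f ` P"
      by (simp add: chains_of_size_def)
    then obtain T where "T \<subseteq> P" "U = f ` T"
      by (auto simp: subset_image_iff)
    then show "U \<in> (`) f ` chains_of_size P t"
      using U chain_iff by blast
  next
    fix U assume "U \<in> (`) f ` chains_of_size P t"
    then obtain T where T: "T \<in> chains_of_size P t" "U = f ` T"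
      by blast
    then have "T \<subseteq> P"
      by (simp add: chains_of_size_def)
    then show "U \<in> chains_of_size (f ` P) t"
      using T chain_iff by blast
  qed
  moreover have "inj_on ((`) f) (chains_of_size P t)"
    by (rule inj_on_subset[OF inj_on_image_Pow[OF inj]]) (auto simp: chains_of_size_def)
  ultimately show ?thesis
    by (simp add: card_image)
qed

lemma card_chains_of_copy:
  assumes "S \<in> copies p n"
  shows "card (chains_of_size S t) = num_chains p t"
proof -
  obtain f where "S = f ` boolean_lattice p" "inj_on f (boolean_lattice p)"
      "\<forall>x\<in>boolean_lattice p. \<forall>y\<in>boolean_lattice p. x \<le> y \<longleftrightarrow> f x \<le> f y"
    using assms unfolding copies_def induced_copies_def by blast
  then show ?thesis
    unfolding num_chains_def t_chains_def by (simp only: card_chains_of_size_embedding_image)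
qed

lemma chains_of_copy:
  assumes "S \<in> copies p n"
  shows "chains_of_size S t = {T \<in> t_chains n t. T \<subseteq> S}"
  unfolding t_chains_def using chains_of_size_subset[OF copies_subset[OF assms]] .

text \<open>Double counting of the pairs \<open>T \<subseteq> S\<close> of a chain and a copy.\<close>

lemma sum_copies_containing:
  "(\<Sum>T\<in>t_chains n t. copies_containing p n T) = num_copies p n * num_chains p t"
proof -
  have "(\<Sum>T\<in>t_chains n t. copies_containing p n T)
      = (\<Sum>T\<in>t_chains n t. \<Sum>S | S \<in> copies p n \<and> T \<subseteq> S. 1)"
    by (simp add: copies_containing_def)
  also have "\<dots> = (\<Sum>S\<in>copies p n. \<Sum>T | T \<in> t_chains n t \<and> T \<subseteq> S. 1)"
    by (rule sum.swap_restrict[OF finite_t_chains finite_copies])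
  also have "\<dots> = (\<Sum>S\<in>copies p n. num_chains p t)"
  proof (rule sum.cong[OF refl])
    fix S assume "S \<in> copies p n"
    then show "(\<Sum>T | T \<in> t_chains n t \<and> T \<subseteq> S. 1) = num_chains p t"
      using chains_of_copy card_chains_of_copy by (metis card_eq_sum)
  qed
  finally show ?thesis
    by (simp add: num_copies_def)
qed

lemma num_chains_mult_C_min_le:
  "num_chains n t * C_min p n (t_chains n t) \<le> num_copies p n * num_chains p t"
proof -
  have "C_min p n (t_chains n t) \<le> copies_containing p n T" if "T \<in> t_chains n t" for T
    unfolding C_min_def using that by (intro Min_le) (auto simp: finite_t_chains)
  then have "(\<Sum>T\<in>t_chains n t. C_min p n (t_chains n t))
      \<le> (\<Sum>T\<in>t_chains n t. copies_containing p n T)"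
    by (rule sum_mono)
  then show ?thesis
    by (simp add: sum_copies_containing num_chains_def)
qed

section \<open>Disjoint copies\<close>

text \<open>
  The copy of \<open>B\<^sub>p\<close> living on the block of points \<open>i (p + 1) + 1, \<dots>, i (p + 1) + (p + 1)\<close>. The last
  point of the block lies in every set of the copy: without it the empty set would belong to the
  copies of all blocks.
\<close>

definition block_embedding :: "nat \<Rightarrow> nat \<Rightarrow> nat set \<Rightarrow> nat set" where
  "block_embedding p i X = (\<lambda>x. i * (p + 1) + x) ` insert (p + 1) X"

lemma block_embedding_le_iff:
  assumes "X \<in> boolean_lattice p" "Y \<in> boolean_lattice p"
  shows "block_embedding p i X \<subseteq> block_embedding p i Y \<longleftrightarrow> X \<subseteq> Y"
proof -
  have "p + 1 \<notin> X" "p + 1 \<notin> Y"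
    using assms by (auto simp: boolean_lattice_def)
  then show ?thesis
    unfolding block_embedding_def by (subst inj_image_subset_iff) (auto simp: inj_def)
qed

lemma in_block_embeddingE:
  assumes "X \<in> boolean_lattice p" "y \<in> block_embedding p i X"
  obtains x where "y = i * (p + 1) + x" "1 \<le> x" "x \<le> p + 1"
proof -
  obtain x where x: "x \<in> insert (p + 1) X" "y = i * (p + 1) + x"
    using assms(2) unfolding block_embedding_def by blast
  then have "1 \<le> x" "x \<le> p + 1"
    using assms(1) by (auto simp: boolean_lattice_def)
  then show ?thesis
    using that x(2) by blast
qed

lemma block_embedding_copy:
  assumes "(i + 1) * (p + 1) \<le> n"
  shows "block_embedding p i ` boolean_lattice p \<in> copies p n"
proof -
  have "inj_on (block_embedding p i) (boolean_lattice p)"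
    using block_embedding_le_iff by (intro inj_onI) (metis subset_antisym order_refl)
  moreover have "block_embedding p i X \<subseteq> {1..n}" if "X \<in> boolean_lattice p" for X
  proof
    fix y assume "y \<in> block_embedding p i X"
    with that obtain x where "y = i * (p + 1) + x" "1 \<le> x" "x \<le> p + 1"
      by (rule in_block_embeddingE)
    then show "y \<in> {1..n}"
      using assms by (auto simp: algebra_simps)
  qed
  then have "block_embedding p i ` boolean_lattice p \<subseteq> boolean_lattice n"
    by (auto simp: boolean_lattice_def)
  moreover have "\<forall>X\<in>boolean_lattice p. \<forall>Y\<in>boolean_lattice p.
      X \<le> Y \<longleftrightarrow> block_embedding p i X \<le> block_embedding p i Y"
    by (simp add: block_embedding_le_iff)
  ultimately show ?thesis
    unfolding copies_def induced_copies_def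
    by (intro CollectI exI[of _ "block_embedding p i"] conjI refl)
qed

text \<open>The block is determined by any of its points \<open>y\<close>, as the quotient of \<open>y - 1\<close> by \<open>p + 1\<close>.\<close>

lemma block_embedding_index:
  assumes "X \<in> boolean_lattice p" "y \<in> block_embedding p i X"
  shows "(y - 1) div (p + 1) = i"
proof -
  obtain x where x: "y = i * (p + 1) + x" "1 \<le> x" "x \<le> p + 1"
    using assms by (rule in_block_embeddingE)
  then have "y - 1 = i * (p + 1) + (x - 1)" and "x - 1 < p + 1"
    by auto
  have "(i * (p + 1) + (x - 1)) div (p + 1) = i + (x - 1) div (p + 1)"
    by (rule div_mult_self3) simp
  with \<open>y - 1 = i * (p + 1) + (x - 1)\<close> \<open>x - 1 < p + 1\<close> show ?thesis
    by simp
qed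

lemma block_embedding_eq_index:
  assumes "X \<in> boolean_lattice p" "Y \<in> boolean_lattice p"
    and "block_embedding p i X = block_embedding p j Y"
  shows "i = j"
proof -
  have "i * (p + 1) + (p + 1) \<in> block_embedding p i X"
    by (simp add: block_embedding_def)
  then show ?thesis
    using assms block_embedding_index by metis
qed

lemma disjoint_block_copies:
  obtains \<D> where "\<D> \<subseteq> copies p n" "pairwise disjnt \<D>" "card \<D> = n div (p + 1)"
proof
  let ?copy = "\<lambda>i. block_embedding p i ` boolean_lattice p"
  let ?D = "?copy ` {..<n div (p + 1)}"
  have disj: "disjnt (?copy i) (?copy j)" if "i \<noteq> j" for i j
    using that block_embedding_eq_index unfolding disjnt_def by blast
  show "pairwise disjnt ?D"
    unfolding pairwise_image using disj by (auto simp: pairwise_def)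
  have "?copy i \<noteq> {}" for i
    by (auto simp: boolean_lattice_def)
  then have "inj_on ?copy {..<n div (p + 1)}"
    using disj by (intro inj_onI) (metis disjnt_self_iff_empty)
  then show "card ?D = n div (p + 1)"
    by (simp add: card_image)
  show "?D \<subseteq> copies p n"
  proof
    fix S assume "S \<in> ?D"
    then obtain i where i: "i < n div (p + 1)" "S = ?copy i"
      by blast
    then have "(i + 1) * (p + 1) \<le> n div (p + 1) * (p + 1)"
      by (intro mult_right_mono) auto
    also have "\<dots> \<le> n"
      by (rule div_times_less_eq_dividend)
    finally show "S \<in> copies p n"
      using block_embedding_copy i(2) by simp
  qed
qed

section \<open>Colour classes of strong colourings\<close>

text \<open>
  Every copy in \<open>\<D>\<close> contains a chain that avoids the colour \<open>y\<close>, and disjointness of the copies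
  makes these chains distinct; here \<open>t \<ge> 1\<close> excludes the empty chain, which lies in every copy.
\<close>

lemma color_class_plus_disjoint_copies_le:
  assumes strong: "strong_coloring n p q t c" and "2 \<le> q" "1 \<le> t"
    and sub: "\<D> \<subseteq> copies p n" and disj: "pairwise disjnt \<D>"
  shows "card {T \<in> t_chains n t. c T = y} + card \<D> \<le> num_chains n t"
proof -
  have "\<exists>T \<in> chains_of_size S t. c T \<noteq> y" if "S \<in> \<D>" for S
  proof (rule ccontr)
    assume "\<not> ?thesis"
    then have "c ` chains_of_size S t \<subseteq> {y}"
      by auto
    then have "card (c ` chains_of_size S t) \<le> card {y}"
      by (rule card_mono[rotated]) simp
    moreover have "q \<le> card (c ` chains_of_size S t)"
      using strong sub that unfolding strong_coloring_def by blast
    ultimately show False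
      using \<open>2 \<le> q\<close> by simp
  qed
  then obtain w where w: "w S \<in> chains_of_size S t" "c (w S) \<noteq> y" if "S \<in> \<D>" for S
    by metis
  have w_sub: "w S \<subseteq> S" "w S \<noteq> {}" if "S \<in> \<D>" for S
    using w(1)[OF that] \<open>1 \<le> t\<close> by (auto simp: chains_of_size_def)
  have "inj_on w \<D>"
  proof (rule inj_onI)
    fix S S' assume S: "S \<in> \<D>" "S' \<in> \<D>" "w S = w S'"
    then have "\<not> disjnt S S'"
      using w_sub[of S] w_sub[of S'] by (auto simp: disjnt_def)
    then show "S = S'"
      using disj S unfolding pairwise_def by blast
  qed
  then have "card \<D> = card (w ` \<D>)"
    by (simp add: card_image)
  moreover have "w ` \<D> \<subseteq> {T \<in> t_chains n t. c T \<noteq> y}"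
    using w sub chains_of_copy by blast
  then have "card (w ` \<D>) \<le> card {T \<in> t_chains n t. c T \<noteq> y}"
    by (intro card_mono) (simp_all add: finite_t_chains)
  moreover have "card {T \<in> t_chains n t. c T = y} + card {T \<in> t_chains n t. c T \<noteq> y}
      = num_chains n t"
    unfolding num_chains_def
    by (subst card_Un_disjoint[symmetric]) (auto simp: finite_t_chains intro: arg_cong[where f = card])
  ultimately show ?thesis
    by linarith
qed

lemma card_le_image_mult_fibre_bound:
  assumes "finite A" and "\<And>y. y \<in> c ` A \<Longrightarrow> card {x \<in> A. c x = y} \<le> M"
  shows "card A \<le> card (c ` A) * M"
proof -
  have "card A = (\<Sum>y\<in>c ` A. card {x \<in> A. c x = y})"
    using sum.image_gen[OF assms(1), of "\<lambda>_. 1::nat" c] by simp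
  also have "\<dots> \<le> card (c ` A) * M"
    using sum_bounded_above[of "c ` A" "\<lambda>y. card {x \<in> A. c x = y}" M] assms(2) by simp
  finally show ?thesis .
qed

lemma strong_coloring_num_colors_ge_block_bound:
  assumes "strong_coloring n p q t c" "2 \<le> q" "1 \<le> t"
  shows "num_chains n t \<le> card (c ` t_chains n t) * (num_chains n t - n div (p + 1))"
proof -
  obtain \<D> where \<D>: "\<D> \<subseteq> copies p n" "pairwise disjnt \<D>" "card \<D> = n div (p + 1)"
    by (rule disjoint_block_copies)
  have "card {T \<in> t_chains n t. c T = y} \<le> num_chains n t - n div (p + 1)" for y
    using color_class_plus_disjoint_copies_le[OF assms \<D>(1,2), of y] \<D>(3) by simp
  then show ?thesis
    unfolding num_chains_def by (intro card_le_image_mult_fibre_bound finite_t_chains)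
qed

lemma strong_coloring_exists:
  assumes "q \<le> num_chains p t"
  shows "\<exists>c :: nat set set \<Rightarrow> nat. strong_coloring n p q t c"
proof -
  obtain c :: "nat set set \<Rightarrow> nat" where c: "inj_on c (t_chains n t)"
    using finite_imp_inj_to_nat_seg[OF finite_t_chains] by metis
  have "q \<le> card (c ` chains_of_size S t)" if "S \<in> copies p n" for S
  proof -
    have "inj_on c (chains_of_size S t)"
      using c chains_of_copy[OF that] by (auto intro: inj_on_subset)
    then show ?thesis
      using assms card_chains_of_copy[OF that] by (simp add: card_image)
  qed
  then show ?thesis
    unfolding strong_coloring_def by blast
qed

lemma f_sharp_attained:
  assumes "q \<le> num_chains p t"
  obtains c :: "nat set set \<Rightarrow> nat"
  where "strong_coloring n p q t c" "card (c ` t_chains n t) = f_sharp t n p q"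
proof -
  have "\<exists>c :: nat set set \<Rightarrow> nat.
      strong_coloring n p q t c \<and> card (c ` t_chains n t) = f_sharp t n p q"
    unfolding f_sharp_def by (rule LeastI_ex) (use strong_coloring_exists[OF assms] in blast)
  then show ?thesis
    using that by blast
qed

section \<open>The lower bound\<close>

theorem theorem1p6:
  fixes n p q t :: nat
  assumes "n \<ge> 2 * p + 1" and "1 \<le> t" and "t \<le> p" and "2 \<le> q" and "q \<le> num_chains p t"
  shows "int (f_sharp t n p q) \<ge>
    max \<lceil>real (num_chains n t) / (real (num_chains n t) - real_of_int \<lfloor>real n / real (p + 1)\<rfloor>)\<rceil>
        \<lceil>real (num_chains n t) * real (C_min p n (t_chains n t)) / (real (num_copies p n) * real (num_chains p t))\<rceil>"
proof -
  obtain c :: "nat set set \<Rightarrow> nat" where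
    c: "strong_coloring n p q t c" and k: "card (c ` t_chains n t) = f_sharp t n p q"
    using f_sharp_attained[OF assms(5)] by blast
  let ?k = "f_sharp t n p q" and ?h = "num_chains n t" and ?m = "n div (p + 1)"
  have floor_eq: "\<lfloor>real n / real (p + 1)\<rfloor> = int ?m"
    by (rule floor_divide_of_nat_eq)
  have bound: "?h \<le> ?k * (?h - ?m)"
    using strong_coloring_num_colors_ge_block_bound[OF c assms(4,2)] k by simp
  have first: "real ?h / (real ?h - real ?m) \<le> real ?k"
  proof (cases "?m < ?h")
    case True
    then have "real ?h \<le> real ?k * (real ?h - real ?m)"
      using bound by (metis less_imp_le of_nat_diff of_nat_le_iff of_nat_mult)
    then show ?thesis
      using True by (simp add: divide_le_eq)
  next
    case False
    \<comment> \<open>The denominator is nonpositive, hence so is the quotient (by \<open>x / 0 = 0\<close> if it vanishes).\<close>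
    then have "real ?h / (real ?h - real ?m) \<le> 0"
      by (simp add: divide_nonneg_nonpos)
    then show ?thesis
      by (meson of_nat_0_le_iff order_trans)
  qed
  have second: "real ?h * real (C_min p n (t_chains n t))
      / (real (num_copies p n) * real (num_chains p t)) \<le> real ?k"
  proof (cases "?h = 0")
    case False
    have "real ?h * real (C_min p n (t_chains n t)) \<le> real (num_copies p n) * real (num_chains p t)"
      using num_chains_mult_C_min_le by (metis of_nat_le_iff of_nat_mult)
    then have "real ?h * real (C_min p n (t_chains n t))
        / (real (num_copies p n) * real (num_chains p t)) \<le> 1"
      by (simp add: divide_le_eq mult_less_0_iff)
    moreover have "1 \<le> real ?k"
      using bound False by (cases ?k) auto
    ultimately show ?thesis
      by linarith
  qed simp
  show ?thesis
    unfolding floor_eq using first second by (simp add: ceiling_le_iff)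
qed

end
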